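(* Let $x\mapsto|\psi_x\rangle$ be a differentiable family of unit vectors in a complex Hilbert space $\mathcal H$, let $\{K_\omega\}_{\omega\in\Omega}$ be a measurement with POVM operators $E_\omega=K_\omega^\dagger K_\omega$, and fix a value of $x$ and an outcome $\omega$ such that $E_\omega$ is regular, i.e. $\sqrt{E_\omega}\,|\psi_x\rangle\neq 0$. Then, with the quantities $I_\omega(\rho_x)$, $I^{\mathrm{cl}}_\omega(p(\omega|x))$, $I(\sigma_{x|\omega})$ and $I_\omega(\sigma_x^{\mathrm{SA}})$ defined in the context, the following equivalences hold: (T1) $I_\omega(\sigma_x^{\mathrm{SA}})=I_\omega(\rho_x)$ if and only if $\operatorname{Im}\langle\partial_x^\perp\psi_x|E_\omega|\psi_x\rangle=0$. (T2) $I(\sigma_{x|\omega})=0$ if and only if $\sqrt{E_\omega}\,|\partial_x^\perp\psi_x\rangle=c\,\sqrt{E_\omega}\,|\psi_x\rangle$ for some $c\in\mathbb C$. (T3) $I^{\mathrm{cl}}_\omega(p(\omega|x))=0$ if and only if $\operatorname{Re}\langle\partial_x^\perp\psi_x|E_\omega|\psi_x\rangle=0$. (T4) $p(\omega|x)\,I(\sigma_{x|\omega})=I_\omega(\rho_x)$ if and only if $\sqrt{E_\omega}\,|\partial_x^\perp\psi_x\rangle\perp\sqrt{E_\omega}\,|\psi_x\rangle$. (T5) $I^{\mathrm{cl}}_\omega(p(\omega|x))=I_\omega(\rho_x)$ if and only if $\sqrt{E_\omega}\,|\partial_x^\perp\psi_x\rangle=c\,\sqrt{E_\omega}\,|\psi_x\rangle$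 for some $c\in\mathbb R$.
   Context: Setting. $\rho_x=|\psi_x\rangle\langle\psi_x|$ is a pure state depending differentiably on a real parameter $x$. Put $|\partial_x^\perp\psi_x\rangle=|\partial_x\psi_x\rangle-\langle\psi_x|\partial_x\psi_x\rangle|\psi_x\rangle$. A measurement is a finite family of bounded operators $\{K_\omega\}_{\omega\in\Omega}$ with $E_\omega=K_\omega^\dagger K_\omega\ge0$ and $\sum_{\omega\in\Omega}E_\omega=\mathbb I$. The operators $K_\omega$ are held fixed when differentiating with respect to $x$ (only $|\psi_x\rangle$ is differentiated). The outcome probability is $p(\omega|x)=\langle\psi_x|E_\omega|\psi_x\rangle$, and when it is nonzero the post-measurement state is $\sigma_{x|\omega}=K_\omega\rho_xK_\omega^\dagger/p(\omega|x)$, the projector onto the unit vector $|\psi_{x|\omega}\rangle=K_\omega|\psi_x\rangle/\sqrt{p(\omega|x)}$. Information quantities. For a pure state given by unit vectors $|\chi_x\rangle$, the quantum Fisher information (QFI) is $I=4\left(\langle\partial_x\chi_x|\partial_x\chi_x\rangle-|\langle\chi_x|\partial_x\chi_x\rangle|^2\right)$; $I(\sigma_{x|\omega})$ is this quantity for $|\chi_x\rangle=|\psi_{x|\omega}\rangle$. Further, $$I_\omega(\rho_x)=4\langle\partial_x^\perp\psi_x|E_\omega|\partial_x^\perp\psi_x\rangle,\qquad I^{\mathrm{cl}}_\omega(p(\omega|x))=\frac{[\partial_xp(\omega|x)]^2}{p(\omega|x)},$$ $$I_\omega(\sigma_x^{\mathrm{SA}})=I^{\mathrm{cl}}_\omega(p(\omega|x))+p(\omega|x)\,I(\sigma_{x|\omega}).$$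 *)

theory Defs
  imports "HOL-Analysis.Analysis"
begin

text \<open>
  Complex Hilbert spaces. The real inner product space underlying a complex one (scalar
  multiplication restricted to the reals, inner product the real part of the complex one) is
  kept as the superclass, so that norm, topology, completeness and derivatives along a real
  parameter are the library notions. The complex inner product is conjugate-linear in its
  first argument, as in Dirac notation.
\<close>

class complex_inner = real_inner +
  fixes scaleC :: "complex \<Rightarrow> 'a \<Rightarrow> 'a" (infixr "*\<^sub>C" 75)
    and cinner :: "'a \<Rightarrow> 'a \<Rightarrow> complex"
  assumes scaleC_add_right: "a *\<^sub>C (u + v) = a *\<^sub>C u + a *\<^sub>C v"
    and scaleC_add_left: "(a + b) *\<^sub>C u = a *\<^sub>C u + b *\<^sub>C u"
    and scaleC_scaleC: "a *\<^sub>C (b *\<^sub>C u) = (a * b) *\<^sub>C u"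
    and scaleC_of_real: "complex_of_real r *\<^sub>C u = r *\<^sub>R u"
    and cinner_commute: "cinner u v = cnj (cinner v u)"
    and cinner_add_right: "cinner u (v + w) = cinner u v + cinner u w"
    and cinner_scaleC_right: "cinner u (a *\<^sub>C v) = a * cinner u v"
    and Re_cinner: "Re (cinner u v) = inner u v"

class chilbert_space = complex_inner + complete_space

definition bounded_clinear :: "('a::complex_inner \<Rightarrow> 'b::complex_inner) \<Rightarrow> bool" where
  "bounded_clinear A \<longleftrightarrow> bounded_linear A \<and> (\<forall>c v. A (c *\<^sub>C v) = c *\<^sub>C A v)"

text \<open>For bounded operators between Hilbert spaces the adjoint exists and is unique.\<close>

definition cadjoint :: "('a::chilbert_space \<Rightarrow> 'b::chilbert_space) \<Rightarrow> 'b \<Rightarrow> 'a" where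
  "cadjoint A = (THE B. \<forall>v w. cinner (A v) w = cinner v (B w))"

definition positive_op :: "('a::chilbert_space \<Rightarrow> 'a) \<Rightarrow> bool" where
  "positive_op A \<longleftrightarrow>
     bounded_clinear A \<and> (\<forall>v. Im (cinner v (A v)) = 0 \<and> 0 \<le> Re (cinner v (A v)))"

text \<open>
  The positive square root; every positive operator has exactly one, so the choice operator
  leaves no ambiguity there.
\<close>

definition op_sqrt :: "('a::chilbert_space \<Rightarrow> 'a) \<Rightarrow> 'a \<Rightarrow> 'a" where
  "op_sqrt A = (SOME S. positive_op S \<and> S \<circ> S = A)"

definition povm_op :: "('w \<Rightarrow> 'a::chilbert_space \<Rightarrow> 'a) \<Rightarrow> 'w \<Rightarrow> 'a \<Rightarrow> 'a" where
  "povm_op K \<omega> = cadjoint (K \<omega>) \<circ> K \<omega>"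

definition measurement :: "'w set \<Rightarrow> ('w \<Rightarrow> 'a::chilbert_space \<Rightarrow> 'a) \<Rightarrow> bool" where
  "measurement \<Omega> K \<longleftrightarrow>
     finite \<Omega> \<and>
     (\<forall>\<omega>\<in>\<Omega>. bounded_clinear (K \<omega>) \<and> positive_op (povm_op K \<omega>)) \<and>
     (\<forall>v. (\<Sum>\<omega>\<in>\<Omega>. povm_op K \<omega> v) = v)"

definition perp_deriv :: "(real \<Rightarrow> 'a::chilbert_space) \<Rightarrow> real \<Rightarrow> 'a" where
  "perp_deriv \<psi> x =
     vector_derivative \<psi> (at x) - cinner (\<psi> x) (vector_derivative \<psi> (at x)) *\<^sub>C \<psi> x"

definition qfi :: "(real \<Rightarrow> 'a::chilbert_space) \<Rightarrow> real \<Rightarrow> real" where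
  "qfi \<phi> x =
     4 * (Re (cinner (vector_derivative \<phi> (at x)) (vector_derivative \<phi> (at x)))
          - (cmod (cinner (\<phi> x) (vector_derivative \<phi> (at x))))\<^sup>2)"

text \<open>
  The expectations in the next two definitions are real because the operators are
  positive; the real part only adjusts the type.
\<close>

definition outcome_prob ::
    "(real \<Rightarrow> 'a::chilbert_space) \<Rightarrow> ('w \<Rightarrow> 'a \<Rightarrow> 'a) \<Rightarrow> 'w \<Rightarrow> real \<Rightarrow> real" where
  "outcome_prob \<psi> K \<omega> x = Re (cinner (\<psi> x) (povm_op K \<omega> (\<psi> x)))"

definition qfi_outcome ::
    "(real \<Rightarrow> 'a::chilbert_space) \<Rightarrow> ('w \<Rightarrow> 'a \<Rightarrow> 'a) \<Rightarrow> 'w \<Rightarrow> real \<Rightarrow> real" where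
  "qfi_outcome \<psi> K \<omega> x = 4 * Re (cinner (perp_deriv \<psi> x) (povm_op K \<omega> (perp_deriv \<psi> x)))"

text \<open>
  Where the outcome probability vanishes this is the zero vector. By continuity of the
  probability that does not affect the derivative at a point with nonzero probability.
\<close>

definition post_state ::
    "(real \<Rightarrow> 'a::chilbert_space) \<Rightarrow> ('w \<Rightarrow> 'a \<Rightarrow> 'a) \<Rightarrow> 'w \<Rightarrow> real \<Rightarrow> 'a" where
  "post_state \<psi> K \<omega> x = (1 / sqrt (outcome_prob \<psi> K \<omega> x)) *\<^sub>R K \<omega> (\<psi> x)"

definition cfi_outcome ::
    "(real \<Rightarrow> 'a::chilbert_space) \<Rightarrow> ('w \<Rightarrow> 'a \<Rightarrow> 'a) \<Rightarrow> 'w \<Rightarrow> real \<Rightarrow> real" where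
  "cfi_outcome \<psi> K \<omega> x = (deriv (outcome_prob \<psi> K \<omega>) x)\<^sup>2 / outcome_prob \<psi> K \<omega> x"

definition qfi_SA ::
    "(real \<Rightarrow> 'a::chilbert_space) \<Rightarrow> ('w \<Rightarrow> 'a \<Rightarrow> 'a) \<Rightarrow> 'w \<Rightarrow> real \<Rightarrow> real" where
  "qfi_SA \<psi> K \<omega> x =
     cfi_outcome \<psi> K \<omega> x + outcome_prob \<psi> K \<omega> x * qfi (post_state \<psi> K \<omega>) x"

end

(*
Put a = K psi and d = K psi_perp for the chosen outcome. Since the unit vectors psi have
Re <psi, psi'> = 0, the vectors K psi' and d differ by an imaginary multiple of a, so
I_cl = 4 (Re <a,d>)^2 / |a|^2 and p I(sigma) = 4 (|d|^2 - |<a,d>|^2 / |a|^2), while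
I_omega = 4 |d|^2. The claims T2 and T5 are then the equality cases of the complex and the real
Cauchy-Schwarz inequality, carried over to sqrt E by <sqrt E v, sqrt E w> = <K v, K w>.
*)
theory Submission
  imports Defs
begin

subsection \<open>Complex inner product spaces\<close>

lemma cinner_add_left: "cinner (u + v) w = cinner u w + cinner (v::'a::complex_inner) w"
  by (metis cinner_add_right cinner_commute complex_cnj_add)

lemma cinner_scaleC_left: "cinner (a *\<^sub>C u) (v::'a::complex_inner) = cnj a * cinner u v"
  by (metis cinner_commute cinner_scaleC_right complex_cnj_mult)

lemma cinner_scaleR_right: "cinner u (r *\<^sub>R (v::'a::complex_inner)) = of_real r * cinner u v"
  by (metis cinner_scaleC_right scaleC_of_real)

lemma cinner_scaleR_left: "cinner (r *\<^sub>R u) (v::'a::complex_inner) = of_real r * cinner u v"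
  by (metis cinner_scaleC_left scaleC_of_real complex_cnj_complex_of_real)

lemma cinner_diff_right: "cinner u (v - w) = cinner u v - cinner u (w::'a::complex_inner)"
  by (metis cinner_add_right diff_add_cancel eq_diff_eq)

lemma cinner_diff_left: "cinner (u - v) w = cinner u w - cinner (v::'a::complex_inner) w"
  by (metis cinner_add_left diff_add_cancel eq_diff_eq)

lemma cinner_self: "cinner v v = of_real ((norm (v::'a::complex_inner))\<^sup>2)"
proof (rule complex_eqI)
  show "Re (cinner v v) = Re (of_real ((norm v)\<^sup>2))"
    by (simp add: Re_cinner power2_norm_eq_inner)
  have "Im (cinner v v) = - Im (cinner v v)"
    by (metis cinner_commute cnj.sel(2))
  then show "Im (cinner v v) = Im (of_real ((norm v)\<^sup>2))" by simp
qed

text \<open>Conjugate-linearity on the left turns \<open>\<i>\<close> into \<open>- \<i>\<close>,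
  whose product with a complex number has the imaginary part of that number as real part.
  Real-valued identities valid for all vectors thereby become complex ones.\<close>

lemma Im_cinner: "Im (cinner u v) = inner (\<i> *\<^sub>C u) (v::'a::complex_inner)"
  by (simp add: Re_cinner[symmetric] cinner_scaleC_left)

lemma cinner_eq_iff:
  fixes v w :: "'a::complex_inner"
  shows "(\<forall>u. cinner u v = cinner u w) \<longleftrightarrow> v = w"
proof
  assume "\<forall>u. cinner u v = cinner u w"
  then have "\<forall>u. inner u v = inner u w" by (metis Re_cinner)
  then have "inner (v - w) (v - w) = 0" by (simp add: inner_diff_right)
  then show "v = w" by simp
qed simp

lemma scaleC_diff_right: "a *\<^sub>C (u - v) = a *\<^sub>C u - a *\<^sub>C (v::'a::complex_inner)"
  by (metis scaleC_add_right diff_add_cancel eq_diff_eq)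

lemma scaleC_scaleR_commute: "a *\<^sub>C (r *\<^sub>R v) = r *\<^sub>R (a *\<^sub>C (v::'a::complex_inner))"
  by (metis scaleC_of_real scaleC_scaleC mult.commute)

text \<open>In fact the norm is multiplicative. Boundedness allows complex scalars to be pulled
  through limits later.\<close>

lemma bounded_linear_scaleC: "bounded_linear (\<lambda>v::'a::complex_inner. a *\<^sub>C v)"
proof (rule bounded_linear_intro)
  fix v :: 'a
  have "of_real ((norm (a *\<^sub>C v))\<^sup>2) = (a * cnj a) * cinner v v"
    by (metis cinner_self cinner_scaleC_left cinner_scaleC_right mult.assoc mult.commute)
  also have "\<dots> = of_real ((cmod a * norm v)\<^sup>2)"
    by (simp add: cinner_self complex_norm_square[symmetric] power_mult_distrib)
  finally have "(norm (a *\<^sub>C v))\<^sup>2 = (cmod a * norm v)\<^sup>2"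
    using of_real_eq_iff by blast
  then show "norm (a *\<^sub>C v) \<le> norm v * cmod a"
    by (simp add: mult.commute)
qed (simp_all add: scaleC_add_right scaleC_scaleR_commute)

section \<open>Equality cases of the Cauchy-Schwarz inequality\<close>

text \<open>The residual of \<open>e\<close> after orthogonal projection onto \<open>a\<close> has
  squared norm \<open>(norm e)^2 - |cinner a e|^2 / (norm a)^2\<close>, which is zero under the
  stated equality.\<close>

lemma cauchy_schwarz_eq_complex:
  fixes a e :: "'a::complex_inner"
  assumes "a \<noteq> 0"
  shows "(norm e)\<^sup>2 * (norm a)\<^sup>2 = (cmod (cinner a e))\<^sup>2 \<longleftrightarrow> (\<exists>c. e = c *\<^sub>C a)"
proof
  define c where "c = cinner a e / of_real ((norm a)\<^sup>2)"
  assume eq: "(norm e)\<^sup>2 * (norm a)\<^sup>2 = (cmod (cinner a e))\<^sup>2"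
  have "of_real ((norm (e - c *\<^sub>C a))\<^sup>2) =
      cinner e e - c * cinner e a - cnj c * cinner a e + cnj c * c * cinner a a"
    unfolding cinner_self[symmetric]
    by (simp add: cinner_diff_left cinner_diff_right cinner_scaleC_left cinner_scaleC_right algebra_simps)
  also have "\<dots> = cinner e e - c * cnj (cinner a e)"
  proof -
    have "c * cinner a a = cinner a e" using assms by (simp add: c_def cinner_self)
    then show ?thesis by (simp add: mult.assoc flip: cinner_commute[of e a])
  qed
  also have "\<dots> = of_real ((norm e)\<^sup>2 - (cmod (cinner a e))\<^sup>2 / (norm a)\<^sup>2)"
    by (simp add: c_def cinner_self complex_norm_square del: of_real_power)
  also have "(norm e)\<^sup>2 - (cmod (cinner a e))\<^sup>2 / (norm a)\<^sup>2 = 0"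
    using eq[symmetric] assms by simp
  finally have "e = c *\<^sub>C a" by simp
  then show "\<exists>c. e = c *\<^sub>C a" ..
next
  assume "\<exists>c. e = c *\<^sub>C a"
  then obtain c where c: "e = c *\<^sub>C a" ..
  have "of_real ((norm e)\<^sup>2) = cnj c * c * of_real ((norm a)\<^sup>2)"
    unfolding cinner_self[symmetric] c
    by (simp add: cinner_scaleC_left cinner_scaleC_right)
  also have "\<dots> = of_real ((cmod c)\<^sup>2 * (norm a)\<^sup>2)"
    by (simp add: complex_norm_square mult.commute del: of_real_power)
  finally have "(norm e)\<^sup>2 = (cmod c)\<^sup>2 * (norm a)\<^sup>2" using of_real_eq_iff by blast
  then show "(norm e)\<^sup>2 * (norm a)\<^sup>2 = (cmod (cinner a e))\<^sup>2"
    by (simp add: c cinner_scaleC_right cinner_self norm_mult norm_power power_mult_distrib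
        power2_eq_square)
qed

text \<open>The same projection argument for the underlying real inner product; here the coefficient
  comes out real, as T5 demands.\<close>

lemma cauchy_schwarz_eq_real:
  fixes a e :: "'a::real_inner"
  assumes "a \<noteq> 0"
  shows "(norm e)\<^sup>2 * (norm a)\<^sup>2 = (inner a e)\<^sup>2 \<longleftrightarrow> (\<exists>c. e = c *\<^sub>R a)"
proof
  define c where "c = inner a e / (norm a)\<^sup>2"
  assume eq: "(norm e)\<^sup>2 * (norm a)\<^sup>2 = (inner a e)\<^sup>2"
  have "(norm (e - c *\<^sub>R a))\<^sup>2 = (norm e)\<^sup>2 - 2 * c * inner a e + c * (c * (norm a)\<^sup>2)"
    by (simp add: power2_norm_eq_inner inner_diff_left inner_diff_right inner_commute algebra_simps)
  also have "\<dots> = (norm e)\<^sup>2 - (inner a e)\<^sup>2 / (norm a)\<^sup>2"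
    using assms by (simp add: c_def power2_eq_square)
  also have "\<dots> = 0"
    using assms by (simp add: eq[symmetric])
  finally have "e = c *\<^sub>R a" by simp
  then show "\<exists>c. e = c *\<^sub>R a" ..
qed (auto simp: power_mult_distrib dot_square_norm power2_eq_square)

subsection \<open>Riesz representation and adjoints\<close>

text \<open>At its minimiser \<open>t = - c / n\<close> the quadratic takes the value
  \<open>- c^2 / n\<close>. This serves as the first-order condition at a minimum.\<close>

lemma quadratic_nonneg_imp_linear_zero:
  fixes c n :: real
  assumes "\<And>t. 0 \<le> t\<^sup>2 * n + 2 * t * c" and "n > 0"
  shows "c = 0"
proof -
  have "0 \<le> (- c / n)\<^sup>2 * n + 2 * (- c / n) * c" by (rule assms)
  also have "\<dots> = - (c\<^sup>2 / n)" using assms(2) by (simp add: field_simps power2_eq_square)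
  finally show ?thesis using assms(2) by (simp add: divide_le_0_iff)
qed

text \<open>The representing vector is the minimiser of \<open>\<lambda>v. (norm v)\<^sup>2 - 2 * f v\<close>; minimising
  sequences are Cauchy by the parallelogram law.\<close>

lemma riesz_representation:
  fixes f :: "'a::{real_inner,complete_space} \<Rightarrow> real"
  assumes "bounded_linear f"
  obtains u where "\<And>v. f v = inner v u"
proof -
  interpret f: bounded_linear f by fact
  define J where "J = (\<lambda>v. (norm v)\<^sup>2 - 2 * f v)"
  define m where "m = Inf (range J)"
  obtain C where C: "\<And>v. norm (f v) \<le> norm v * C" using f.bounded by auto
  \<comment> \<open>Completing the square: \<open>J v\<close> is at least
    \<open>(norm v - C)^2 - C^2\<close>.\<close>
  have "- (C\<^sup>2) \<le> J v" for v
  proof -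
    have "f v \<le> norm v * C" using C[of v] by simp
    moreover have "0 \<le> (norm v - C)\<^sup>2" by simp
    ultimately show ?thesis by (simp add: J_def power2_diff)
  qed
  then have bdd: "bdd_below (range J)" by (auto intro!: bdd_belowI)
  have m: "m \<le> J v" for v unfolding m_def by (rule cInf_lower[OF _ bdd]) simp
  have "\<exists>v. J v < m + 1 / real (Suc n)" for n
    using cInf_lessD[of "range J" "m + 1 / real (Suc n)"] unfolding m_def by auto
  then obtain V where V: "\<And>n. J (V n) < m + 1 / real (Suc n)" by metis
  \<comment> \<open>The midpoint of \<open>u\<close> and \<open>v\<close> cannot lie below the
    infimum \<open>m\<close>, so two near-minimisers are close to each other.\<close>
  have par: "(norm (u - v))\<^sup>2 \<le> 2 * (J u - m) + 2 * (J v - m)" for u v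
  proof -
    have "J u + J v - 2 * J ((1/2) *\<^sub>R (u + v)) = (norm (u - v))\<^sup>2 / 2"
      by (simp add: J_def f.add f.scaleR power2_norm_eq_inner inner_add_left inner_add_right
          inner_diff_left inner_diff_right inner_commute field_simps)
    then show ?thesis using m[of "(1/2) *\<^sub>R (u + v)"] by simp
  qed
  have "Cauchy V"
  proof (rule metric_CauchyI)
    fix e :: real assume e: "e > 0"
    \<comment> \<open>Both excesses over \<open>m\<close> enter \<open>par\<close> with factor 2, so
      a quarter of \<open>e^2\<close> for each suffices.\<close>
    obtain N where N: "1 / real (Suc N) < e\<^sup>2 / 4"
      using nat_approx_posE[of "e\<^sup>2 / 4"] e by auto
    have "dist (V i) (V j) < e" if "i \<ge> N" "j \<ge> N" for i j
    proof -
      have *: "J (V k) - m < e\<^sup>2 / 4" if "k \<ge> N" for k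
      proof -
        have "1 / real (Suc k) \<le> 1 / real (Suc N)" using that by (simp add: frac_le)
        then show ?thesis using V[of k] N by linarith
      qed
      have "(norm (V i - V j))\<^sup>2 < e\<^sup>2"
      proof (rule order.strict_trans1[OF par])
        show "2 * (J (V i) - m) + 2 * (J (V j) - m) < e\<^sup>2"
          using *[OF that(1)] *[OF that(2)] by argo
      qed
      then show ?thesis using e by (simp add: dist_norm power2_less_imp_less)
    qed
    then show "\<exists>M. \<forall>i\<ge>M. \<forall>j\<ge>M. dist (V i) (V j) < e" by blast
  qed
  then obtain u where u: "V \<longlonglongrightarrow> u" by (meson Cauchy_convergent convergentD)
  have "(\<lambda>n. J (V n)) \<longlonglongrightarrow> J u"
    unfolding J_def by (intro tendsto_intros f.tendsto u)
  moreover have "(\<lambda>n. m + 1 / real (Suc n)) \<longlonglongrightarrow> m"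
    using tendsto_add[OF tendsto_const LIMSEQ_inverse_real_of_nat, of m]
    by (simp add: inverse_eq_divide)
  ultimately have "J u \<le> m"
    by (rule LIMSEQ_le) (use V less_imp_le in blast)
  then have min: "J u \<le> J v" for v using m order_trans by blast
  have "f v = inner v u" for v
  proof (cases "v = 0")
    case False
    \<comment> \<open>Minimality of \<open>u\<close> along the line through \<open>u\<close> in
      direction \<open>v\<close>; the linear coefficient must then vanish.\<close>
    have "0 \<le> t\<^sup>2 * (norm v)\<^sup>2 + 2 * t * (inner v u - f v)" for t
    proof -
      have "J (u + t *\<^sub>R v) - J u = t\<^sup>2 * (norm v)\<^sup>2 + 2 * t * (inner v u - f v)"
        by (simp add: J_def f.add f.scaleR power2_norm_eq_inner inner_add_left inner_add_right
            inner_commute algebra_simps power2_eq_square[of t])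
      then show ?thesis using min[of "u + t *\<^sub>R v"] by simp
    qed
    then have "inner v u - f v = 0"
      by (rule quadratic_nonneg_imp_linear_zero) (use False in simp)
    then show ?thesis by simp
  qed (simp add: f.zero)
  then show thesis by (rule that)
qed

text \<open>Riesz representation of \<open>\<lambda>v. inner (A v) w\<close> gives the adjoint for
  the real inner product. As \<open>A\<close> commutes with \<open>\<i>\<close>, the imaginary parts
  agree too, and nondegeneracy gives the uniqueness that \<open>THE\<close> asks for.\<close>

lemma cinner_cadjoint:
  fixes A :: "'a::chilbert_space \<Rightarrow> 'b::chilbert_space"
  assumes "bounded_clinear A"
  shows "cinner v (cadjoint A w) = cinner (A v) w"
proof -
  have bl: "bounded_linear A" and sc: "\<And>c v. A (c *\<^sub>C v) = c *\<^sub>C A v"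
    using assms by (auto simp: bounded_clinear_def)
  have "\<exists>u. \<forall>v. inner (A v) w = inner v u" for w
  proof -
    have "bounded_linear (\<lambda>v. inner (A v) w)"
      by (rule bounded_linear_compose[OF bounded_linear_inner_left bl])
    then show ?thesis by (rule riesz_representation) blast
  qed
  then obtain B where B: "\<And>w v. inner (A v) w = inner v (B w)" by metis
  have "cinner (A v) w = cinner v (B w)" for v w
  proof (rule complex_eqI)
    show "Re (cinner (A v) w) = Re (cinner v (B w))" by (simp add: Re_cinner B)
    show "Im (cinner (A v) w) = Im (cinner v (B w))" by (simp add: Im_cinner B flip: sc)
  qed
  then have "\<exists>!B. \<forall>v w. cinner (A v) w = cinner v (B w)"
    by (metis cinner_eq_iff ext)
  from theI'[OF this] show ?thesis unfolding cadjoint_def by metis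
qed

subsection \<open>Positive square roots\<close>

text \<open>Polarisation: reality of the quadratic form at \<open>v + w\<close> matches the
  imaginary parts of \<open>cinner v (A w)\<close> and \<open>cnj (cinner w (A v))\<close>, and
  reality at \<open>v + \<i> *\<^sub>C w\<close> matches their real parts.\<close>

lemma positive_op_selfadjoint:
  assumes "positive_op A"
  shows "cinner v (A w) = cinner (A v) w"
proof -
  have bl: "bounded_linear A" and sc: "\<And>c v. A (c *\<^sub>C v) = c *\<^sub>C A v"
    and im: "\<And>v. Im (cinner v (A v)) = 0"
    using assms by (auto simp: bounded_clinear_def positive_op_def)
  note add = linear_add[OF bounded_linear.linear[OF bl]]
  have "Im (cinner (v + w) (A (v + w))) = 0" "Im (cinner (v + \<i> *\<^sub>C w) (A (v + \<i> *\<^sub>C w))) = 0"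
    by (rule im)+
  then have "cinner v (A w) = cnj (cinner w (A v))"
    using im[of v] im[of w]
    by (simp add: complex_eq_iff add sc cinner_add_left cinner_add_right cinner_scaleC_left
        cinner_scaleC_right)
  then show ?thesis by (simp flip: cinner_commute)
qed

section \<open>A norm-convergent iteration for square roots\<close>

instance chilbert_space \<subseteq> banach ..

text \<open>For \<open>\<parallel>B\<parallel> \<le> 1\<close> the iteration \<open>Y \<mapsto> (B + Y\<^sup>2) / 2\<close> converges in norm, its increments being
  dominated by those of the scalar iteration \<open>y \<mapsto> (1 + y\<^sup>2) / 2\<close>; the limit satisfies
  \<open>(1 - Y)\<^sup>2 = 1 - B\<close>.\<close>

primrec scalar_iter :: "nat \<Rightarrow> real" where
  "scalar_iter 0 = 0"
| "scalar_iter (Suc n) = (1 + (scalar_iter n)\<^sup>2) / 2"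

primrec op_iter :: "('a::real_normed_vector \<Rightarrow>\<^sub>L 'a) \<Rightarrow> nat \<Rightarrow> 'a \<Rightarrow>\<^sub>L 'a" where
  "op_iter B 0 = 0"
| "op_iter B (Suc n) = (1/2) *\<^sub>R (B + (op_iter B n o\<^sub>L op_iter B n))"

lemma scalar_iter_bounds: "0 \<le> scalar_iter n \<and> scalar_iter n \<le> 1"
  by (induction n) (auto simp: power_le_one)

lemma scalar_iter_mono: "scalar_iter n \<le> scalar_iter (Suc n)"
proof -
  have "0 \<le> (1 - scalar_iter n)\<^sup>2" by simp
  then show ?thesis by (simp add: power2_diff)
qed

lemma scalar_iter_convergent: "convergent scalar_iter"
  using scalar_iter_bounds scalar_iter_mono
  by (intro Bseq_mono_convergent BseqI'[of _ 1] monoI)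
    (auto intro: lift_Suc_mono_le[of scalar_iter])

text \<open>Each iterate is a polynomial in \<open>B\<close>. Applied twice, this shows that the
  iterates commute with one another.\<close>

lemma op_iter_commute:
  assumes "A o\<^sub>L B = B o\<^sub>L A"
  shows "A o\<^sub>L op_iter B n = op_iter B n o\<^sub>L A"
proof (induction n)
  case (Suc n)
  have 1: "A (B v) = B (A v)" for v
    using assms by (metis blinfun_apply_blinfun_compose)
  have 2: "A (op_iter B n v) = op_iter B n (A v)" for v
    using Suc by (metis blinfun_apply_blinfun_compose)
  show ?case
    by (rule blinfun_eqI)
      (simp add: 1 2 blinfun.add_left blinfun.add_right blinfun.scaleR_left blinfun.scaleR_right)
qed (auto intro: blinfun_eqI)

lemma norm_op_iter_le:
  assumes "norm B \<le> 1"
  shows "norm (op_iter B n) \<le> scalar_iter n"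
proof (induction n)
  case (Suc n)
  have "norm (op_iter B n o\<^sub>L op_iter B n) \<le> scalar_iter n * scalar_iter n"
    by (rule order_trans[OF norm_blinfun_compose])
      (use Suc scalar_iter_bounds[of n] in \<open>auto intro: mult_mono\<close>)
  then have "norm (B + (op_iter B n o\<^sub>L op_iter B n)) \<le> 1 + (scalar_iter n)\<^sup>2"
    using assms by (intro norm_triangle_le) (simp add: power2_eq_square)
  then show ?case by simp
qed simp

lemma norm_op_iter_diff_le:
  assumes "norm B \<le> 1"
  shows "norm (op_iter B (Suc n) - op_iter B n) \<le> scalar_iter (Suc n) - scalar_iter n"
proof (induction n)
  case 0
  then show ?case using assms by simp
next
  case (Suc n)
  let ?Y = "op_iter B (Suc n)" and ?Z = "op_iter B n"
  let ?y = "scalar_iter (Suc n)" and ?z = "scalar_iter n"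
  have "?Y o\<^sub>L ?Z = ?Z o\<^sub>L ?Y"
    by (intro op_iter_commute op_iter_commute[symmetric] refl)
  then have c: "?Y (?Z v) = ?Z (?Y v)" for v
    by (metis blinfun_apply_blinfun_compose)
  have "op_iter B (Suc (Suc n)) - ?Y = (1/2) *\<^sub>R ((?Y o\<^sub>L ?Y) - (?Z o\<^sub>L ?Z))"
    by (subst (2) op_iter.simps(2), subst op_iter.simps(2))
      (simp add: scaleR_diff_right scaleR_add_right del: op_iter.simps)
  \<comment> \<open>Factoring a difference of squares is legitimate because the two iterates commute
    (\<open>c\<close>); the scalar increments factor in the same way.\<close>
  also have "(?Y o\<^sub>L ?Y) - (?Z o\<^sub>L ?Z) = (?Y + ?Z) o\<^sub>L (?Y - ?Z)"
    by (rule blinfun_eqI)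
      (simp add: blinfun.add_left blinfun.diff_left blinfun.diff_right c del: op_iter.simps)
  finally have "norm (op_iter B (Suc (Suc n)) - ?Y) = norm ((?Y + ?Z) o\<^sub>L (?Y - ?Z)) / 2"
    by (simp del: op_iter.simps)
  also have "\<dots> \<le> (norm (?Y + ?Z) * norm (?Y - ?Z)) / 2"
    by (intro divide_right_mono norm_blinfun_compose) simp
  also have "\<dots> \<le> ((?y + ?z) * (?y - ?z)) / 2"
  proof (intro divide_right_mono mult_mono)
    show "norm (?Y + ?Z) \<le> ?y + ?z"
      by (intro norm_triangle_le add_mono norm_op_iter_le assms)
    show "0 \<le> ?y + ?z" using scalar_iter_bounds by (simp only: add_nonneg_nonneg)
  qed (use Suc in auto)
  also have "\<dots> = scalar_iter (Suc (Suc n)) - ?y"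
  proof -
    have "(?y + ?z) * (?y - ?z) = ?y\<^sup>2 - ?z\<^sup>2"
      by (simp add: power2_eq_square algebra_simps del: scalar_iter.simps)
    then show ?thesis
      using scalar_iter.simps(2)[of "Suc n"] scalar_iter.simps(2)[of n] by argo
  qed
  finally show ?case .
qed

lemma norm_op_iter_diff_le':
  assumes "norm B \<le> 1" "m \<le> n"
  shows "norm (op_iter B n - op_iter B m) \<le> scalar_iter n - scalar_iter m"
  using assms(2)
proof (induction n rule: dec_induct)
  case (step n)
  have "norm ((op_iter B (Suc n) - op_iter B n) + (op_iter B n - op_iter B m))
      \<le> (scalar_iter (Suc n) - scalar_iter n) + (scalar_iter n - scalar_iter m)"
    by (intro norm_triangle_le add_mono norm_op_iter_diff_le assms(1) step.IH)
  then show ?case by (simp only: diff_add_cancel add_diff_eq)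
qed simp

lemma op_iter_convergent:
  fixes B :: "'a::banach \<Rightarrow>\<^sub>L 'a"
  assumes "norm B \<le> 1"
  shows "convergent (op_iter B)"
proof (rule Cauchy_convergent, rule metric_CauchyI)
  fix e :: real assume "e > 0"
  have "Cauchy scalar_iter" by (rule convergent_Cauchy[OF scalar_iter_convergent])
  from metric_CauchyD[OF this \<open>e > 0\<close>] obtain M
    where M: "\<And>i j. i \<ge> M \<Longrightarrow> j \<ge> M \<Longrightarrow> dist (scalar_iter i) (scalar_iter j) < e" by blast
  have *: "dist (op_iter B i) (op_iter B j) < e" if "i \<ge> M" "j \<ge> i" for i j
    using norm_op_iter_diff_le'[OF assms that(2)] M[of j i] that
    by (simp add: dist_norm norm_minus_commute[of "op_iter B i"])
  have "dist (op_iter B i) (op_iter B j) < e" if "i \<ge> M" "j \<ge> M" for i j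
    using *[of i j] *[of j i] that by (metis dist_commute nle_le)
  then show "\<exists>M. \<forall>i\<ge>M. \<forall>j\<ge>M. dist (op_iter B i) (op_iter B j) < e" by blast
qed

lemma op_iter_scaleC:
  fixes B :: "'a::complex_inner \<Rightarrow>\<^sub>L 'a"
  assumes "\<And>c v. B (c *\<^sub>C v) = c *\<^sub>C B v"
  shows "op_iter B n (c *\<^sub>C v) = c *\<^sub>C op_iter B n v"
  by (induction n arbitrary: v)
    (simp_all add: assms blinfun.add_left blinfun.scaleR_left scaleC_add_right
      scaleC_scaleR_commute linear_0[OF bounded_linear.linear[OF bounded_linear_scaleC]])

lemma op_iter_selfadjoint:
  fixes B :: "'a::real_inner \<Rightarrow>\<^sub>L 'a"
  assumes "\<And>v w. inner v (B w) = inner (B v) w"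
  shows "inner v (op_iter B n w) = inner (op_iter B n v) w"
  by (induction n arbitrary: v w)
    (simp_all add: assms blinfun.add_left blinfun.scaleR_left inner_add_left inner_add_right)

section \<open>Existence of the positive square root\<close>

text \<open>Positivity is tested at \<open>v - (1/M) *\<^sub>R A v\<close>, and the remaining term
  \<open>inner w (A w)\<close> is bounded by \<open>M * (norm w)^2\<close>. In operator form this is
  \<open>A^2 \<le> M A\<close>, used to bound the norm of \<open>1 - A / M\<close>.\<close>

lemma positive_op_norm_le:
  assumes "positive_op A" and M: "\<And>v. norm (A v) \<le> norm v * M" and "M > 0"
  shows "(norm (A v))\<^sup>2 \<le> M * inner v (A v)"
proof -
  have bl: "bounded_linear A" using assms(1) by (simp add: bounded_clinear_def positive_op_def)
  have pos: "0 \<le> inner v (A v)" for v using assms(1) by (simp add: positive_op_def Re_cinner)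
  have sa: "inner v (A w) = inner (A v) w" for v w
    using positive_op_selfadjoint[OF assms(1), of v w] by (metis Re_cinner)
  define w where "w = A v"
  have "0 \<le> inner (v - (1/M) *\<^sub>R w) (A (v - (1/M) *\<^sub>R w))" by (rule pos)
  also have "\<dots> = inner v w - 2/M * (norm w)\<^sup>2 + (1/M) * (1/M) * inner w (A w)"
    by (simp add: linear_diff[OF bounded_linear.linear[OF bl]]
        linear_scale[OF bounded_linear.linear[OF bl]] inner_diff_left inner_diff_right
        sa[of v w] w_def[symmetric] power2_norm_eq_inner diff_divide_distrib)
  also have "\<dots> \<le> inner v w - 2/M * (norm w)\<^sup>2 + (1/M) * (1/M) * (M * (norm w)\<^sup>2)"
  proof -
    have "inner w (A w) \<le> norm w * norm (A w)" by (rule norm_cauchy_schwarz)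
    also have "\<dots> \<le> norm w * (norm w * M)" by (intro mult_left_mono M) simp
    finally have "inner w (A w) \<le> M * (norm w)\<^sup>2" by (simp add: power2_eq_square mult.left_commute mult.commute)
    then show ?thesis using \<open>M > 0\<close> by (intro add_left_mono mult_left_mono) auto
  qed
  also have "\<dots> = inner v w - (norm w)\<^sup>2 / M" using \<open>M > 0\<close> by (simp add: field_simps)
  finally show ?thesis using \<open>M > 0\<close> by (simp add: w_def field_simps)
qed

theorem positive_op_sqrt_exists:
  fixes A :: "'a::chilbert_space \<Rightarrow> 'a"
  assumes "positive_op A"
  obtains S where "positive_op S" "S \<circ> S = A"
proof -
  have bl: "bounded_linear A" and sc: "\<And>c v. A (c *\<^sub>C v) = c *\<^sub>C A v"
    using assms by (auto simp: bounded_clinear_def positive_op_def)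
  have saA: "inner v (A w) = inner (A v) w" for v w
    using positive_op_selfadjoint[OF assms, of v w] by (metis Re_cinner)
  obtain M where "M > 0" and M: "\<And>v. norm (A v) \<le> norm v * M"
    using bounded_linear.pos_bounded[OF bl] by blast
  \<comment> \<open>Rescaling by \<open>M\<close> makes \<open>B\<close> a contraction, so the
    iteration applies and its limit \<open>Y\<close> satisfies
    \<open>(1 - Y)^2 = 1 - B = A / M\<close>.\<close>
  define B where "B = id_blinfun - (1/M) *\<^sub>R Blinfun A"
  have B: "B v = v - (1/M) *\<^sub>R A v" for v
    by (simp add: B_def blinfun.diff_left blinfun.scaleR_left bounded_linear_Blinfun_apply[OF bl])
  have "norm B \<le> 1"
  proof (rule norm_blinfun_bound)
    fix v
    have "(norm (B v))\<^sup>2 = (norm v)\<^sup>2 - 2/M * inner v (A v) + (1/M) * (1/M) * (norm (A v))\<^sup>2"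
      by (simp add: B power2_norm_eq_inner inner_diff_left inner_diff_right inner_commute
          diff_divide_distrib)
    also have "\<dots> \<le> (norm v)\<^sup>2 - 2/M * inner v (A v) + (1/M) * (1/M) * (M * inner v (A v))"
      by (intro add_left_mono mult_left_mono positive_op_norm_le assms M \<open>M > 0\<close>) simp
    also have "\<dots> = (norm v)\<^sup>2 - inner v (A v) / M"
      using \<open>M > 0\<close> by (simp add: field_simps power2_eq_square)
    also have "\<dots> \<le> (norm v)\<^sup>2"
      using assms \<open>M > 0\<close> by (simp add: positive_op_def Re_cinner)
    finally show "norm (B v) \<le> 1 * norm v" by (simp add: power2_le_iff_abs_le)
  qed simp
  then obtain Y where Y: "op_iter B \<longlonglongrightarrow> Y" using op_iter_convergent convergentD by blast
  have Yv: "(\<lambda>n. op_iter B n v) \<longlonglongrightarrow> Y v" for v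
    by (intro tendsto_intros Y)
  have "(\<lambda>n. op_iter B (Suc n)) \<longlonglongrightarrow> (1/2) *\<^sub>R (B + (Y o\<^sub>L Y))"
    unfolding op_iter.simps
    by (intro tendsto_intros Y bounded_bilinear.tendsto[OF bounded_bilinear_blinfun_compose])
  with LIMSEQ_Suc[OF Y] have "Y = (1/2) *\<^sub>R (B + (Y o\<^sub>L Y))" by (rule LIMSEQ_unique)
  then have fixpoint: "Y v = (1/2) *\<^sub>R (B v + Y (Y v))" for v
    by (metis blinfun.add_left blinfun.scaleR_left blinfun_apply_blinfun_compose)
  have YY: "Y (Y v) = 2 *\<^sub>R Y v - B v" for v
  proof -
    have "2 *\<^sub>R Y v = 2 *\<^sub>R ((1/2) *\<^sub>R (B v + Y (Y v)))"
      by (rule arg_cong[OF fixpoint])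
    also have "\<dots> = B v + Y (Y v)" by simp
    finally show ?thesis by simp
  qed
  have "norm (op_iter B n) \<le> 1" for n
    using norm_op_iter_le[OF \<open>norm B \<le> 1\<close>, of n] scalar_iter_bounds[of n] by linarith
  \<comment> \<open>This bound makes \<open>1 - Y\<close>, and hence the root \<open>S\<close>
    below, positive.\<close>
  then have "norm Y \<le> 1" by (intro LIMSEQ_le_const2[OF tendsto_norm[OF Y]]) auto
  have scY: "Y (c *\<^sub>C v) = c *\<^sub>C Y v" for c v
  proof (rule LIMSEQ_unique[OF Yv])
    have "B (c *\<^sub>C v) = c *\<^sub>C B v" for c v
      by (simp add: B sc scaleC_diff_right scaleC_scaleR_commute)
    then show "(\<lambda>n. op_iter B n (c *\<^sub>C v)) \<longlonglongrightarrow> c *\<^sub>C Y v"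
      by (simp add: op_iter_scaleC bounded_linear.tendsto[OF bounded_linear_scaleC Yv])
  qed
  have saY: "inner v (Y w) = inner (Y v) w" for v w
  proof (rule LIMSEQ_unique)
    show "(\<lambda>n. inner v (op_iter B n w)) \<longlonglongrightarrow> inner v (Y w)" by (intro tendsto_intros Yv)
    have "inner v (B w) = inner (B v) w" for v w
      by (simp add: B inner_diff_left inner_diff_right saA)
    then have "inner v (op_iter B n w) = inner (op_iter B n v) w" for n
      by (rule op_iter_selfadjoint)
    then show "(\<lambda>n. inner v (op_iter B n w)) \<longlonglongrightarrow> inner (Y v) w"
      by (simp, intro tendsto_intros Yv)
  qed
  define S where "S = (\<lambda>v. sqrt M *\<^sub>R (v - Y v))"
  have scS: "S (c *\<^sub>C v) = c *\<^sub>C S v" for c v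
    by (simp add: S_def scY scaleC_diff_right scaleC_scaleR_commute)
  have saS: "inner v (S w) = inner (S v) w" for v w
    by (simp add: S_def inner_diff_left inner_diff_right saY)
  have "bounded_linear S" unfolding S_def
    by (intro bounded_linear_intros)
  moreover have "Im (cinner v (S v)) = 0" for v
  proof -
    have "inner (\<i> *\<^sub>C v) (S v) = inner (\<i> *\<^sub>C S v) v" by (simp add: saS scS)
    then have "Im (cinner v (S v)) = Im (cinner (S v) v)" by (simp add: Im_cinner)
    also have "\<dots> = - Im (cinner v (S v))" by (subst cinner_commute) simp
    finally show ?thesis by simp
  qed
  moreover have "0 \<le> Re (cinner v (S v))" for v
  proof -
    have "inner v (Y v) \<le> norm v * norm (Y v)" by (rule norm_cauchy_schwarz)
    also have "\<dots> \<le> norm v * (1 * norm v)"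
      by (intro mult_left_mono order_trans[OF norm_blinfun] mult_right_mono \<open>norm Y \<le> 1\<close>) auto
    finally show ?thesis using \<open>M > 0\<close>
      by (simp add: Re_cinner S_def inner_diff_right power2_norm_eq_inner[symmetric] power2_eq_square[symmetric])
  qed
  ultimately have "positive_op S" by (simp add: positive_op_def bounded_clinear_def scS)
  moreover have "S \<circ> S = A"
  proof
    fix v
    \<comment> \<open>Expanding the square leaves \<open>v - 2 Y v + Y (Y v)\<close>, which
      \<open>YY\<close> reduces to \<open>v - B v\<close>.\<close>
    have "S (S v) = M *\<^sub>R (v - Y v - (Y v - Y (Y v)))"
      using \<open>M > 0\<close> by (simp add: S_def blinfun.diff_right blinfun.scaleR_right flip: scaleR_diff_right)
    also have "v - Y v - (Y v - Y (Y v)) = (1/M) *\<^sub>R A v"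
      by (simp add: YY B scaleR_2)
    finally show "(S \<circ> S) v = A v" using \<open>M > 0\<close> by simp
  qed
  ultimately show thesis by (rule that)
qed

text \<open>One factor is moved across by self-adjointness, for whichever root \<open>SOME\<close>
  selects; existence of a root is what gives that choice its properties.\<close>

lemma cinner_op_sqrt:
  fixes A :: "'a::chilbert_space \<Rightarrow> 'a"
  assumes "positive_op A"
  shows "cinner (op_sqrt A v) (op_sqrt A w) = cinner v (A w)"
proof -
  have "\<exists>S. positive_op S \<and> S \<circ> S = A" using positive_op_sqrt_exists[OF assms] by blast
  then have "positive_op (op_sqrt A) \<and> op_sqrt A \<circ> op_sqrt A = A"
    unfolding op_sqrt_def by (rule someI_ex)
  then show ?thesis by (metis comp_apply positive_op_selfadjoint)
qed

subsection \<open>Information quantities\<close>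

text \<open>Both sides are Gram determinants with \<open>a\<close>, which are invariant under adding
  a multiple of \<open>a\<close> to the other vector.\<close>

lemma gram_shift:
  fixes a e :: "'a::complex_inner"
  shows "(norm (e + c *\<^sub>C a))\<^sup>2 * (norm a)\<^sup>2 - (cmod (cinner a (e + c *\<^sub>C a)))\<^sup>2
    = (norm e)\<^sup>2 * (norm a)\<^sup>2 - (cmod (cinner a e))\<^sup>2"
proof -
  have gram: "complex_of_real ((norm u)\<^sup>2 * (norm a)\<^sup>2 - (cmod (cinner a u))\<^sup>2)
      = cinner u u * cinner a a - cinner a u * cinner u a" for u
    by (simp add: cinner_self complex_norm_square del: of_real_power flip: cinner_commute)
  show ?thesis
    by (rule iffD1[OF of_real_eq_iff[where ?'a = complex]], unfold gram)
      (simp add: cinner_add_left cinner_add_right cinner_scaleC_left cinner_scaleC_right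
        algebra_simps)
qed

lemma has_real_derivative_norm_power2:
  fixes \<phi> :: "real \<Rightarrow> 'a::real_inner"
  assumes "(\<phi> has_vector_derivative b) (at x)"
  shows "((\<lambda>y. (norm (\<phi> y))\<^sup>2) has_real_derivative 2 * inner (\<phi> x) b) (at x)"
  using bounded_bilinear.has_vector_derivative[OF bounded_bilinear_inner assms assms]
  by (simp add: power2_norm_eq_inner has_real_derivative_iff_has_vector_derivative inner_commute)

text \<open>The derivative of the normalised curve is \<open>b / norm (\<phi> x)\<close> plus a
  multiple of \<open>\<phi> x\<close>, and \<open>gram_shift\<close> discards such multiples; hence
  \<open>z\<close> is arbitrary. The form \<open>sqrt ((norm (\<phi> y))^2)\<close> matches
  \<open>post_state\<close>, where the probability is a squared norm.\<close>

lemma qfi_normalized: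
  fixes \<phi> :: "real \<Rightarrow> 'a::chilbert_space"
  assumes \<phi>: "(\<phi> has_vector_derivative b) (at x)" and nz: "\<phi> x \<noteq> 0"
  shows "(norm (\<phi> x))\<^sup>2 * qfi (\<lambda>y. (1 / sqrt ((norm (\<phi> y))\<^sup>2)) *\<^sub>R \<phi> y) x
    = 4 * ((norm (b - z *\<^sub>C \<phi> x))\<^sup>2
      - (cmod (cinner (\<phi> x) (b - z *\<^sub>C \<phi> x)))\<^sup>2 / (norm (\<phi> x))\<^sup>2)"
proof -
  define a where "a = \<phi> x"
  define e where "e = b - z *\<^sub>C a"
  define r where "r = 1 / norm a"
  define \<eta> where "\<eta> = (\<lambda>y. (1 / sqrt ((norm (\<phi> y))\<^sup>2)) *\<^sub>R \<phi> y)"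
  have N: "norm a > 0" using nz by (simp add: a_def)
  \<comment> \<open>The value of \<open>r'\<close> can stay open: it multiplies \<open>a\<close> and
    so is absorbed into the shift.\<close>
  obtain r' where "((\<lambda>y. 1 / sqrt ((norm (\<phi> y))\<^sup>2)) has_real_derivative r') (at x)"
  proof -
    have "0 < (norm (\<phi> x))\<^sup>2" and "sqrt ((norm (\<phi> x))\<^sup>2) \<noteq> 0" using nz by simp_all
    from DERIV_divide[OF DERIV_const DERIV_chain2[OF DERIV_real_sqrt[OF this(1)]
        has_real_derivative_norm_power2[OF \<phi>]] this(2)]
    show ?thesis by (rule that)
  qed
  from has_vector_derivative_scaleR[OF this \<phi>]
  have "vector_derivative \<eta> (at x) = r *\<^sub>R b + r' *\<^sub>R a"
    unfolding \<eta>_def by (intro vector_derivative_at) (simp add: r_def a_def)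
  also have "\<dots> = r *\<^sub>R e + (of_real r * z + of_real r') *\<^sub>C a"
    by (simp add: e_def scaleC_add_left scaleC_of_real scaleR_diff_right flip: scaleC_scaleC)
  finally obtain c where \<eta>': "vector_derivative \<eta> (at x) = r *\<^sub>R e + c *\<^sub>C a" by blast
  have \<eta>x: "\<eta> x = r *\<^sub>R a" by (simp add: \<eta>_def r_def a_def)
  have "qfi \<eta> x = 4 * ((norm (r *\<^sub>R e + c *\<^sub>C a))\<^sup>2 - (r * cmod (cinner a (r *\<^sub>R e + c *\<^sub>C a)))\<^sup>2)"
    unfolding qfi_def \<eta>' \<eta>x using N
    by (simp add: cinner_self cinner_scaleR_left norm_mult norm_divide r_def flip: of_real_power)
  \<comment> \<open>Since \<open>r\<close> is \<open>1 / norm a\<close>, inserting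
    \<open>r^2 * (norm a)^2 = 1\<close> in the first term exposes a Gram determinant.\<close>
  also have "\<dots> = 4 * r\<^sup>2 * ((norm (r *\<^sub>R e + c *\<^sub>C a))\<^sup>2 * (norm a)\<^sup>2
      - (cmod (cinner a (r *\<^sub>R e + c *\<^sub>C a)))\<^sup>2)"
    using N by (simp add: r_def field_simps)
  also have "\<dots> = 4 * r\<^sup>2 * ((norm (r *\<^sub>R e))\<^sup>2 * (norm a)\<^sup>2 - (cmod (cinner a (r *\<^sub>R e)))\<^sup>2)"
    by (simp only: gram_shift)
  also have "(norm a)\<^sup>2 * \<dots> = 4 * ((norm e)\<^sup>2 - (cmod (cinner a e))\<^sup>2 / (norm a)\<^sup>2)"
    using N by (simp add: cinner_scaleR_right norm_mult norm_divide r_def power_mult_distrib power_divide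
        field_simps power2_eq_square)
  finally show ?thesis by (simp only: a_def e_def \<eta>_def)
qed

text \<open>The squared norm is constant on the neighbourhood \<open>X\<close> of \<open>x\<close>,
  so its derivative \<open>2 * inner (\<psi> x) b\<close> vanishes.\<close>

lemma inner_vector_derivative_unit:
  fixes \<psi> :: "real \<Rightarrow> 'a::real_inner"
  assumes "open X" "x \<in> X" "\<forall>y\<in>X. norm (\<psi> y) = 1" "(\<psi> has_vector_derivative b) (at x)"
  shows "inner (\<psi> x) b = 0"
proof -
  have "((\<lambda>y. (norm (\<psi> y))\<^sup>2) has_real_derivative 0) (at x)"
    by (rule has_field_derivative_transform_within_open[OF DERIV_const[of 1] assms(1,2)])
      (use assms(3) in simp)
  from DERIV_unique[OF this has_real_derivative_norm_power2[OF assms(4)]] show ?thesis by simp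
qed

theorem mainTheorem1:
  fixes \<psi> :: "real \<Rightarrow> 'a::chilbert_space"
    and X :: "real set" and x :: real
    and \<Omega> :: "'w set" and K :: "'w \<Rightarrow> 'a \<Rightarrow> 'a" and \<omega> :: 'w
  assumes "open X" and "x \<in> X"
    and "\<forall>y\<in>X. \<psi> differentiable (at y)"
    and "\<forall>y\<in>X. norm (\<psi> y) = 1"
    and "measurement \<Omega> K" and "\<omega> \<in> \<Omega>"
    and "op_sqrt (povm_op K \<omega>) (\<psi> x) \<noteq> 0"
  shows "(qfi_SA \<psi> K \<omega> x = qfi_outcome \<psi> K \<omega> x \<longleftrightarrow>
             Im (cinner (perp_deriv \<psi> x) (povm_op K \<omega> (\<psi> x))) = 0) \<and>
         (qfi (post_state \<psi> K \<omega>) x = 0 \<longleftrightarrow>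
             (\<exists>c::complex. op_sqrt (povm_op K \<omega>) (perp_deriv \<psi> x)
             = c *\<^sub>C op_sqrt (povm_op K \<omega>) (\<psi> x))) \<and>
         (cfi_outcome \<psi> K \<omega> x = 0 \<longleftrightarrow>
             Re (cinner (perp_deriv \<psi> x) (povm_op K \<omega> (\<psi> x))) = 0) \<and>
         (outcome_prob \<psi> K \<omega> x * qfi (post_state \<psi> K \<omega>) x = qfi_outcome \<psi> K \<omega> x \<longleftrightarrow>
             cinner (op_sqrt (povm_op K \<omega>) (perp_deriv \<psi> x)) (op_sqrt (povm_op K \<omega>) (\<psi> x)) = 0) \<and>
         (cfi_outcome \<psi> K \<omega> x = qfi_outcome \<psi> K \<omega> x \<longleftrightarrow>
             (\<exists>c::real. op_sqrt (povm_op K \<omega>) (perp_deriv \<psi> x)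
             = complex_of_real c *\<^sub>C op_sqrt (povm_op K \<omega>) (\<psi> x)))"
proof -
  define E where "E = povm_op K \<omega>"
  define S where "S = op_sqrt E"
  define a where "a = K \<omega> (\<psi> x)"
  define d where "d = K \<omega> (perp_deriv \<psi> x)"
  define b where "b = vector_derivative \<psi> (at x)"
  define z where "z = cinner (\<psi> x) b"
  have K: "bounded_clinear (K \<omega>)" and E: "positive_op E"
    using assms(5,6) by (auto simp: measurement_def E_def)
  then have bl: "bounded_linear (K \<omega>)" and sc: "\<And>c v. K \<omega> (c *\<^sub>C v) = c *\<^sub>C K \<omega> v"
    by (auto simp: bounded_clinear_def)
  have KE: "cinner v (E w) = cinner (K \<omega> v) (K \<omega> w)" for v w
    by (simp add: E_def povm_op_def cinner_cadjoint[OF K])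
  have SE: "cinner (S v) (S w) = cinner (K \<omega> v) (K \<omega> w)" for v w
    by (simp add: S_def cinner_op_sqrt[OF E] KE)
  have normS: "norm (S v) = norm (K \<omega> v)" for v
    using SE[of v v] unfolding cinner_self of_real_eq_iff by simp
  have Snz: "S (\<psi> x) \<noteq> 0" using assms(7) by (simp add: S_def E_def)
  \<comment> \<open>Regularity of the outcome thus means positive probability, which justifies every
    division by \<open>(norm a)^2\<close> below.\<close>
  then have anz: "a \<noteq> 0" using normS[of "\<psi> x"] by (auto simp: a_def)
  have b: "(\<psi> has_vector_derivative b) (at x)"
    using assms(2,3) by (simp add: b_def vector_derivative_works)
  have "perp_deriv \<psi> x = b - z *\<^sub>C \<psi> x" by (simp add: perp_deriv_def b_def z_def)
  then have d: "d = K \<omega> b - z *\<^sub>C a"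
    by (simp add: d_def a_def sc linear_diff[OF bounded_linear.linear[OF bl]])
  have Kb: "((\<lambda>y. K \<omega> (\<psi> y)) has_vector_derivative K \<omega> b) (at x)"
    by (rule bounded_linear.has_vector_derivative[OF bl b])
  have p: "outcome_prob \<psi> K \<omega> = (\<lambda>y. (norm (K \<omega> (\<psi> y)))\<^sup>2)"
    by (rule ext) (simp add: outcome_prob_def KE cinner_self flip: E_def)
  have px: "outcome_prob \<psi> K \<omega> x = (norm a)\<^sup>2" by (simp add: p a_def)
  have "Re z = 0"
    using inner_vector_derivative_unit[OF assms(1,2,4) b] by (simp add: z_def Re_cinner)
  \<comment> \<open>A purely imaginary multiple of \<open>a\<close> is orthogonal to
    \<open>a\<close> in the real inner product, so the probability derivative sees only
    \<open>d\<close>.\<close>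
  then have "inner a (z *\<^sub>C a) = 0"
    by (simp add: cinner_scaleC_right cinner_self flip: Re_cinner of_real_power)
  then have "inner a (K \<omega> b) = inner a d" by (simp add: d inner_diff_right)
  then have cl: "cfi_outcome \<psi> K \<omega> x = (2 * inner a d)\<^sup>2 / (norm a)\<^sup>2"
    using DERIV_imp_deriv[OF has_real_derivative_norm_power2[OF Kb]]
    by (simp add: cfi_outcome_def p a_def)
  \<comment> \<open>By \<open>p\<close> the post-measurement state is the normalised curve of
    \<open>K \<omega> (\<psi> y)\<close>; the free shift is set to \<open>z\<close> so that the
    remainder is \<open>d\<close>.\<close>
  have q: "(norm a)\<^sup>2 * qfi (post_state \<psi> K \<omega>) x
      = 4 * ((norm d)\<^sup>2 - (cmod (cinner a d))\<^sup>2 / (norm a)\<^sup>2)"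
    using qfi_normalized[OF Kb, of z] anz by (simp add: d a_def post_state_def[abs_def] p)
  have I: "qfi_outcome \<psi> K \<omega> x = 4 * (norm d)\<^sup>2"
    by (simp add: qfi_outcome_def KE cinner_self d_def flip: E_def of_real_power)
  \<comment> \<open>The arguments come in swapped order, hence the conjugate; vanishing of the real
    or of the imaginary part is unaffected.\<close>
  have ad: "cinner (perp_deriv \<psi> x) (E (\<psi> x)) = cnj (cinner a d)"
    by (simp add: KE a_def d_def flip: cinner_commute)
  have cmod: "(cmod (cinner a d))\<^sup>2 = (inner a d)\<^sup>2 + (Im (cinner a d))\<^sup>2"
    by (simp add: cmod_power2 Re_cinner)
  have S1: "(norm (S (perp_deriv \<psi> x)))\<^sup>2 * (norm (S (\<psi> x)))\<^sup>2 = (norm d)\<^sup>2 * (norm a)\<^sup>2"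
    by (simp add: normS a_def d_def)
  have S2: "cinner (S (\<psi> x)) (S (perp_deriv \<psi> x)) = cinner a d"
    by (simp add: SE a_def d_def)
  have S3: "inner (S (\<psi> x)) (S (perp_deriv \<psi> x)) = inner a d"
    by (simp add: S2 flip: Re_cinner)
  \<comment> \<open>The classical term cancels the real part of \<open>cinner a d\<close> in the
    quantum term, leaving a deficit that involves only the imaginary part.\<close>
  have SA: "qfi_SA \<psi> K \<omega> x = 4 * (norm d)\<^sup>2 - 4 * (Im (cinner a d))\<^sup>2 / (norm a)\<^sup>2"
    unfolding qfi_SA_def px cl q cmod
    by (simp add: power_mult_distrib add_divide_distrib diff_divide_distrib)
  have T1: "qfi_SA \<psi> K \<omega> x = qfi_outcome \<psi> K \<omega> x \<longleftrightarrow>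
      Im (cinner (perp_deriv \<psi> x) (E (\<psi> x))) = 0"
    using anz by (simp add: SA I ad)
  have T2: "qfi (post_state \<psi> K \<omega>) x = 0 \<longleftrightarrow>
      (\<exists>c::complex. S (perp_deriv \<psi> x) = c *\<^sub>C S (\<psi> x))"
  proof -
    have "qfi (post_state \<psi> K \<omega>) x = 0 \<longleftrightarrow> (norm a)\<^sup>2 * qfi (post_state \<psi> K \<omega>) x = 0"
      using anz by simp
    also have "\<dots> \<longleftrightarrow> (norm d)\<^sup>2 * (norm a)\<^sup>2 = (cmod (cinner a d))\<^sup>2"
      unfolding q using anz by (simp add: field_simps)
    also have "\<dots> \<longleftrightarrow> (\<exists>c::complex. S (perp_deriv \<psi> x) = c *\<^sub>C S (\<psi> x))"
      using cauchy_schwarz_eq_complex[OF Snz, of "S (perp_deriv \<psi> x)"] by (simp add: S1 S2)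
    finally show ?thesis .
  qed
  have T3: "cfi_outcome \<psi> K \<omega> x = 0 \<longleftrightarrow> Re (cinner (perp_deriv \<psi> x) (E (\<psi> x))) = 0"
    using anz by (simp add: cl ad Re_cinner)
  have T4: "outcome_prob \<psi> K \<omega> x * qfi (post_state \<psi> K \<omega>) x = qfi_outcome \<psi> K \<omega> x \<longleftrightarrow>
      cinner (S (perp_deriv \<psi> x)) (S (\<psi> x)) = 0"
    using anz by (subst cinner_commute) (simp add: px q I S2)
  have T5: "cfi_outcome \<psi> K \<omega> x = qfi_outcome \<psi> K \<omega> x \<longleftrightarrow>
      (\<exists>c::real. S (perp_deriv \<psi> x) = complex_of_real c *\<^sub>C S (\<psi> x))"
  proof -
    have "cfi_outcome \<psi> K \<omega> x = qfi_outcome \<psi> K \<omega> x \<longleftrightarrow>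
        (norm d)\<^sup>2 * (norm a)\<^sup>2 = (inner a d)\<^sup>2"
      unfolding cl I using anz by (auto simp: field_simps)
    then show ?thesis
      using cauchy_schwarz_eq_real[OF Snz, of "S (perp_deriv \<psi> x)"]
      by (simp add: S1 S3 scaleC_of_real)
  qed
  show ?thesis
    using T1 T2 T3 T4 T5 unfolding S_def E_def by blast
qed

end
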